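(* Let $\mathrm{MP}[1..m]$, $m=2n+1$, be a feasible palindrome array that is not regular. Then an indeterminate string $x$ such that the maximal palindrome array of $x^*$ equals $\mathrm{MP}$ can be computed in $\mathcal{O}(n^2)$ time.
   Context: A letter is a nonempty set of characters; letters match ($\approx$) iff they intersect. A string $x$ is regular if for every tuple $(i,j_1,j_2)$ of distinct positions with $x[j_1]\approx x[i]\approx x[j_2]$ one also has $x[j_1]\approx x[j_2]$; otherwise $x$ is indeterminate. For $x=x_1\cdots x_n$, let $x^*[1..m]=\#x_1\#x_2\#\cdots\#x_n\#$ with $m=2n+1$, where $\#$ is a new symbol matching only itself. The maximal palindrome array $\mathrm{MP}_{x^*}[1..m]$ is given by: $\mathrm{MP}_{x^*}[i]$ is the largest $r\ge0$ with $1\le i-r$, $i+r\le m$ and $x^*[i-k]\approx x^*[i+k]$ for all $1\le k\le r$. An array $\mathrm{MP}[1..m]$ ($m$ odd) is feasible if $\mathrm{MP}=0\,i_2\cdots i_{m-1}\,0$ with, for each $j\in\{2,\dots,m-1\}$, $1-(j\bmod2)\le i_j\le\min(j-1,m-j)$ and $i_j$ odd iff $j$ even. A feasible array is regular if it is the maximal palindrome array $\mathrm{MP}_{x^*}$ of some regular string $x$. *)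

theory Defs
  imports Complex_Main "HOL-Library.Landau_Symbols"
begin

section \<open>Strings of letters\<close>

text \<open>A letter is a set of characters and a string is a list of nonempty letters. Positions are
  numbered from 1.\<close>

definition entry :: "'a list \<Rightarrow> nat \<Rightarrow> 'a" where
  "entry xs i = xs ! (i - 1)"

definition letters_match :: "'c set \<Rightarrow> 'c set \<Rightarrow> bool" (infix \<open>\<approx>\<close> 50) where
  "a \<approx> b \<longleftrightarrow> a \<inter> b \<noteq> {}"

definition is_string :: "'c set list \<Rightarrow> bool" where
  "is_string x \<longleftrightarrow> (\<forall>a\<in>set x. a \<noteq> {})"

definition regular_string :: "'c set list \<Rightarrow> bool" where
  "regular_string x \<longleftrightarrow> is_string x \<and>
     (\<forall>i\<in>{1..length x}. \<forall>j\<^sub>1\<in>{1..length x}. \<forall>j\<^sub>2\<in>{1..length x}.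
        i \<noteq> j\<^sub>1 \<and> i \<noteq> j\<^sub>2 \<and> j\<^sub>1 \<noteq> j\<^sub>2 \<and>
        entry x j\<^sub>1 \<approx> entry x i \<and> entry x i \<approx> entry x j\<^sub>2 \<longrightarrow>
        entry x j\<^sub>1 \<approx> entry x j\<^sub>2)"

definition indeterminate_string :: "'c set list \<Rightarrow> bool" where
  "indeterminate_string x \<longleftrightarrow> is_string x \<and> \<not> regular_string x"

text \<open>The new symbol is the letter \<open>{None}\<close>, which matches only itself.\<close>

definition star :: "'c set list \<Rightarrow> 'c option set list" where
  "star x = {None} # concat (map (\<lambda>a. [Some ` a, {None}]) x)"


section \<open>Palindrome arrays\<close>

definition max_palindrome :: "'c set list \<Rightarrow> nat \<Rightarrow> nat" where
  "max_palindrome y i =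
     Max {r. 1 + r \<le> i \<and> i + r \<le> length y \<and> (\<forall>k\<in>{1..r}. entry y (i - k) \<approx> entry y (i + k))}"

definition max_palindrome_array :: "'c set list \<Rightarrow> nat list" where
  "max_palindrome_array y = map (max_palindrome y) [1..<length y + 1]"

definition feasible :: "nat list \<Rightarrow> bool" where
  "feasible MP \<longleftrightarrow>
     odd (length MP) \<and> entry MP 1 = 0 \<and> entry MP (length MP) = 0 \<and>
     (\<forall>j\<in>{2..length MP - 1}.
        1 - j mod 2 \<le> entry MP j \<and> entry MP j \<le> min (j - 1) (length MP - j) \<and>
        (odd (entry MP j) \<longleftrightarrow> even j))"

text \<open>The natural numbers serve as an unlimited supply of characters.\<close>

definition regular_array :: "nat list \<Rightarrow> bool" where
  "regular_array MP \<longleftrightarrow> feasible MP \<and>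
     (\<exists>x :: nat set list. regular_string x \<and> max_palindrome_array (star x) = MP)"


section \<open>Word RAM\<close>

text \<open>A random access machine with \<open>w\<close>-bit words, on which every instruction costs one unit of
  time. Addition and multiplication wrap around, subtraction is truncated at 0. The machine has
  registers, which instructions name directly, and a memory, which is addressed through register
  contents. It halts when the program counter leaves the program.\<close>

datatype instr =
    Const nat nat         \<comment> \<open>\<open>r := c\<close>\<close>
  | Add nat nat nat       \<comment> \<open>\<open>r := s + t\<close>\<close>
  | Sub nat nat nat       \<comment> \<open>\<open>r := s - t\<close>\<close>
  | Mul nat nat nat       \<comment> \<open>\<open>r := s * t\<close>\<close>
  | Load nat nat          \<comment> \<open>\<open>r := mem[s]\<close>\<close>
  | Store nat nat         \<comment> \<open>\<open>mem[r] := s\<close>\<close>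
  | Jump_le nat nat nat   \<comment> \<open>if \<open>r \<le> s\<close> then go to instruction number \<open>l\<close>\<close>

type_synonym program = "instr list"

record config =
  pc :: nat
  reg :: "nat \<Rightarrow> nat"
  mem :: "nat \<Rightarrow> nat"

definition set_reg :: "nat \<Rightarrow> nat \<Rightarrow> config \<Rightarrow> config" where
  "set_reg r v s = s\<lparr>pc := pc s + 1, reg := (reg s)(r := v)\<rparr>"

fun exec :: "nat \<Rightarrow> instr \<Rightarrow> config \<Rightarrow> config" where
  "exec w (Const r c) s = set_reg r (c mod 2 ^ w) s"
| "exec w (Add r a b) s = set_reg r ((reg s a + reg s b) mod 2 ^ w) s"
| "exec w (Sub r a b) s = set_reg r (reg s a - reg s b) s"
| "exec w (Mul r a b) s = set_reg r ((reg s a * reg s b) mod 2 ^ w) s"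
| "exec w (Load r a) s = set_reg r (mem s (reg s a)) s"
| "exec w (Store r a) s = s\<lparr>pc := pc s + 1, mem := (mem s)(reg s r := reg s a)\<rparr>"
| "exec w (Jump_le a b l) s = s\<lparr>pc := (if reg s a \<le> reg s b then l else pc s + 1)\<rparr>"

definition halted :: "program \<Rightarrow> config \<Rightarrow> bool" where
  "halted P s \<longleftrightarrow> length P \<le> pc s"

definition step :: "nat \<Rightarrow> program \<Rightarrow> config \<Rightarrow> config" where
  "step w P s = (if halted P s then s else exec w (P ! pc s) s)"

text \<open>Initially register 0 holds the length of the input array, memory cells \<open>1, 2, \<dots>\<close> hold the
  array itself, and everything else is 0.\<close>

definition init_config :: "nat list \<Rightarrow> config" where
  "init_config A =
     \<lparr>pc = 0, reg = (\<lambda>_. 0)(0 := length A),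
      mem = (\<lambda>i. if i \<in> {1..length A} then entry A i else 0)\<rparr>"

text \<open>The output string is read off from the memory block whose address is in register 0. In this
  block the letters are listed one after the other, each one as the number of characters listed for
  it, followed by these characters. The number of letters is not stored, so the block determines
  the string only once its length is known.\<close>

definition output_string :: "config \<Rightarrow> nat set list \<Rightarrow> bool" where
  "output_string s x \<longleftrightarrow>
     (\<exists>ls. x = map set ls \<and>
        (let out = concat (map (\<lambda>l. length l # l) ls)
         in \<forall>i<length out. mem s (reg s 0 + i) = out ! i))"

definition computes_within :: "nat \<Rightarrow> program \<Rightarrow> nat \<Rightarrow> nat list \<Rightarrow> nat set list \<Rightarrow> bool" where
  "computes_within w P t A x \<longleftrightarrow>
     length A < 2 ^ w \<and> (\<forall>v\<in>set A. v < 2 ^ w) \<and>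
     (\<exists>k\<le>t. let s = (step w P ^^ k) (init_config A) in halted P s \<and> output_string s x)"

end

theory Submission
  imports Defs "HOL-Real_Asymp.Real_Asymp"
begin

text \<open>Two distinct letters \<open>a\<close>, \<open>b\<close> of \<open>x\<close> are compared at exactly one centre of the extended
  string, so a feasible array prescribes, or leaves free, the matching of each pair independently.
  Give each pair that has to match a private character, and each letter a private one; the
  resulting string has the given array, and it is indeterminate because the array is not regular.
  Listing the characters of all letters takes two nested loops over the positions.\<close>

section \<open>A string with a given feasible array\<close>

text \<open>Letters are numbered from 0 here, so that letters \<open>a\<close> and \<open>b\<close> are mirror images with respect
  to position \<open>a + b + 2\<close> of the extended string. A pair that need not match contributes the
  private character of \<open>a\<close> once more, which makes all lists equally long.\<close>

definition pair_char :: "nat \<Rightarrow> nat \<Rightarrow> nat \<Rightarrow> nat" where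
  "pair_char m a b = (a + b) * m + ((a - b) + (b - a))"

definition mirrored :: "nat list \<Rightarrow> nat \<Rightarrow> nat \<Rightarrow> bool" where
  "mirrored MP a b \<longleftrightarrow> (a - b) + (b - a) \<le> entry MP (a + b + 2)"

definition letter_char :: "nat list \<Rightarrow> nat \<Rightarrow> nat \<Rightarrow> nat" where
  "letter_char MP a b = pair_char (length MP) a (if mirrored MP a b then b else a)"

definition letter_lists :: "nat list \<Rightarrow> nat \<Rightarrow> nat list list" where
  "letter_lists MP n = map (\<lambda>a. map (letter_char MP a) [0..<n]) [0..<n]"

lemma mirrored_commute: "mirrored MP a b \<longleftrightarrow> mirrored MP b a"
  by (simp add: mirrored_def add.commute)

lemma pair_char_commute: "pair_char m a b = pair_char m b a"
  by (simp add: pair_char_def add.commute)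

text \<open>The two truncated differences add up to the distance of the indices, which is below
  \<open>m\<close>. Division by \<open>m\<close> therefore recovers sum and distance, and these
  determine the unordered pair.\<close>

lemma pair_char_eqD:
  assumes "pair_char m a b = pair_char m c d" "a < m" "b < m" "c < m" "d < m"
  shows "a = c \<and> b = d \<or> a = d \<and> b = c"
proof -
  have lt: "(a - b) + (b - a) < m" "(c - d) + (d - c) < m"
    using assms(2-) by linarith+
  have "pair_char m a b div m = a + b" "pair_char m c d div m = c + d"
       "pair_char m a b mod m = (a - b) + (b - a)" "pair_char m c d mod m = (c - d) + (d - c)"
    using lt by (simp_all add: pair_char_def)
  with assms(1) have "a + b = c + d" "(a - b) + (b - a) = (c - d) + (d - c)"
    by simp_all
  then show ?thesis by linarith
qed

text \<open>Every character listed for letter \<open>a\<close> codes a pair containing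
  \<open>a\<close>. A character shared by distinct letters \<open>a\<close> and \<open>b\<close>
  thus codes exactly that pair, and letter \<open>a\<close> lists it only under
  \<open>mirrored MP a b\<close>.\<close>

lemma letter_lists_match_iff:
  assumes "length MP = 2 * n + 1" "a < n" "b < n" "a \<noteq> b"
  shows "map set (letter_lists MP n) ! a \<approx> map set (letter_lists MP n) ! b \<longleftrightarrow> mirrored MP a b"
proof
  let ?m = "length MP"
  assume "map set (letter_lists MP n) ! a \<approx> map set (letter_lists MP n) ! b"
  then obtain c d where cd: "c < n" "d < n" "letter_char MP a c = letter_char MP b d"
    using assms by (auto simp: letters_match_def letter_lists_def)
  define c' where "c' = (if mirrored MP a c then c else a)"
  define d' where "d' = (if mirrored MP b d then d else b)"
  have "a = b \<and> c' = d' \<or> a = d' \<and> c' = b"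
    by (rule pair_char_eqD[of ?m])
      (use cd assms in \<open>auto simp: c'_def d'_def letter_char_def\<close>)
  with assms(4) have "c' = b" by blast
  \<comment> \<open>\<open>c' = b\<close> differs from the default value \<open>a\<close>, so
    \<open>c'\<close> was chosen by the \<open>mirrored\<close> branch, with
    \<open>c = b\<close>.\<close>
  with assms(4) show "mirrored MP a b"
    by (auto simp: c'_def split: if_splits)
next
  assume "mirrored MP a b"
  then have "letter_char MP a b = letter_char MP b a"
    using mirrored_commute[of MP a b] pair_char_commute by (simp add: letter_char_def)
  then have "letter_char MP a b \<in> letter_char MP a ` {0..<n} \<inter> letter_char MP b ` {0..<n}"
    using assms by force
  then have "letter_char MP a ` {0..<n} \<inter> letter_char MP b ` {0..<n} \<noteq> {}"
    by blast
  then show "map set (letter_lists MP n) ! a \<approx> map set (letter_lists MP n) ! b"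
    using assms by (simp add: letters_match_def letter_lists_def)
qed

lemma is_string_letter_lists: "is_string (map set (letter_lists MP n))"
  by (auto simp: is_string_def letter_lists_def)

section \<open>Palindromes of the extended string\<close>

lemma length_star: "length (star x) = 2 * length x + 1"
  by (induction x) (auto simp: star_def)

lemma nth_star:
  "i \<le> 2 * length x \<Longrightarrow> star x ! i = (if even i then {None} else Some ` (x ! (i div 2)))"
proof (induction x arbitrary: i)
  case Nil
  then show ?case by (simp add: star_def)
next
  case (Cons a x)
  have star: "star (a # x) = {None} # (Some ` a) # star x" by (simp add: star_def)
  consider "i = 0" | "i = 1" | k where "i = Suc (Suc k)"
    by (metis One_nat_def not0_implies_Suc)
  then show ?case
    by cases (use Cons in \<open>auto simp: star\<close>)
qed

text \<open>\<open>i - k\<close> and \<open>i + k\<close> have the same parity. Odd positions carry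
  the new symbol, and position \<open>2 * p\<close> carries the letter with index
  \<open>p - 1\<close>.\<close>

lemma star_match_iff:
  assumes "length x = n" "k < i" "i + k \<le> 2 * n + 1" "k \<ge> 1"
  shows "entry (star x) (i - k) \<approx> entry (star x) (i + k) \<longleftrightarrow>
    odd (i + k) \<or> x ! ((i - k) div 2 - 1) \<approx> x ! ((i + k) div 2 - 1)"
proof (cases "odd (i + k)")
  case True
  then have "even (i + k - 1)" "even (i - k - 1)" using assms(2) by presburger+
  then show ?thesis using True assms
    by (simp add: entry_def nth_star letters_match_def)
next
  case False
  then obtain p q where pq: "i - k = 2 * p" "i + k = 2 * q"
    using assms(2) by (metis dvdE even_diff_nat less_or_eq_imp_le)
  then obtain p' q' where "p = Suc p'" "q = Suc q'"
    using assms(2) by (cases p; cases q) auto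
  then show ?thesis using pq assms
    by (auto simp: entry_def nth_star letters_match_def)
qed

lemma feasible_bounds:
  assumes "feasible MP" "1 \<le> i" "i \<le> length MP"
  shows "entry MP i + 1 \<le> i" "i + entry MP i \<le> length MP"
proof -
  have "entry MP i + 1 \<le> i \<and> i + entry MP i \<le> length MP"
  proof (cases "i = 1 \<or> i = length MP")
    case True
    then show ?thesis using assms by (auto simp: feasible_def)
  next
    case False
    then have "i \<in> {2..length MP - 1}" using assms by auto
    then have "entry MP i \<le> min (i - 1) (length MP - i)"
      using assms(1) by (auto simp: feasible_def)
    then show ?thesis using assms by auto
  qed
  then show "entry MP i + 1 \<le> i" "i + entry MP i \<le> length MP" by simp_all
qed

text \<open>Around centre \<open>i\<close>, the offsets that compare two letters match exactly up to
  \<open>entry MP i\<close>; all others compare the new symbol with itself.\<close>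

lemma max_palindrome_array_letter_lists:
  assumes len: "length MP = 2 * n + 1" and feas: "feasible MP"
  shows "max_palindrome_array (star (map set (letter_lists MP n))) = MP"
proof -
  define x where "x = map set (letter_lists MP n)"
  have lx: "length x = n" by (simp add: x_def letter_lists_def)
  have match_iff: "entry (star x) (i - k) \<approx> entry (star x) (i + k) \<longleftrightarrow>
      odd (i + k) \<or> k \<le> entry MP i"
    if "1 \<le> k" and ki: "k < i" and "i + k \<le> 2 * n + 1" for i k
  proof (cases "odd (i + k)")
    case True
    then show ?thesis using star_match_iff[OF lx] that by simp
  next
    case False
    then obtain p q where pq: "i - k = 2 * p" "i + k = 2 * q"
      using that by (metis dvdE even_diff_nat less_or_eq_imp_le)
    then obtain a b where ab: "p = Suc a" "q = Suc b"
      using ki by (cases p; cases q) auto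
    have *: "a < n" "b < n" "a \<noteq> b" "i = a + b + 2" "(a - b) + (b - a) = k"
      using pq ab that by auto
    have "x ! ((i - k) div 2 - 1) \<approx> x ! ((i + k) div 2 - 1) \<longleftrightarrow> x ! a \<approx> x ! b"
      unfolding pq ab by simp
    also have "\<dots> \<longleftrightarrow> mirrored MP a b"
      unfolding x_def using letter_lists_match_iff[OF len] * by blast
    also have "\<dots> \<longleftrightarrow> k \<le> entry MP i"
      using * by (simp add: mirrored_def)
    finally show ?thesis using star_match_iff[OF lx] that by simp
  qed
  have "max_palindrome (star x) i = entry MP i" if i: "1 \<le> i" "i \<le> 2 * n + 1" for i
    unfolding max_palindrome_def
  proof (rule Max_eqI)
    let ?R = "{r. 1 + r \<le> i \<and> i + r \<le> length (star x) \<and>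
      (\<forall>k\<in>{1..r}. entry (star x) (i - k) \<approx> entry (star x) (i + k))}"
    show "finite ?R"
      by (rule finite_subset[of _ "{..i}"]) auto
    show "entry MP i \<in> ?R"
      using feasible_bounds[OF feas, of i] i len match_iff lx by (auto simp: length_star)
    fix r assume r: "r \<in> ?R"
    show "r \<le> entry MP i"
    proof (rule ccontr)
      assume "\<not> r \<le> entry MP i"
      then have k: "entry MP i + 1 \<le> r" by simp
      then have "i \<in> {2..length MP - 1}" using r len lx by (auto simp: length_star)
      \<comment> \<open>The parity condition of feasibility makes the first offset beyond
        \<open>entry MP i\<close> compare two letters, which do not match, so no larger radius is
        possible.\<close>
      then have "even (i + (entry MP i + 1))" using feas by (auto simp: feasible_def)
      moreover have "entry (star x) (i - (entry MP i + 1)) \<approx> entry (star x) (i + (entry MP i + 1))"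
        using r k by fastforce
      ultimately show False
        using match_iff[of "entry MP i + 1" i] r k lx by (auto simp: length_star)
    qed
  qed
  then show ?thesis
    unfolding x_def[symmetric] max_palindrome_array_def
    by (intro nth_equalityI) (auto simp: length_star lx len entry_def simp del: upt_Suc)
qed


section \<open>The program\<close>

text \<open>Registers 3 and 4 hold the loop variables \<open>a\<close> and \<open>b\<close>, register 5 holds \<open>2 n\<close>, register 6
  the address of the current letter, and register 8 the next cell to be written; register 12 is
  never assigned, hence 0. As the machine cannot halve, \<open>n\<close> is known only as the value of \<open>b\<close> on
  leaving the inner loop, and the number of characters of a letter is written after them.\<close>

definition string_program :: program where
  "string_program =
    [Const 1 1,
     Const 2 2,
     Sub 5 0 1,
     Add 6 0 1,
     Add 7 3 3,
     Jump_le 5 7 29,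
     Const 4 0,
     Add 8 6 1,
     Add 7 4 4,
     Jump_le 5 7 25,
     Sub 9 3 4,
     Sub 10 4 3,
     Add 9 9 10,
     Add 10 3 4,
     Add 11 10 2,
     Load 11 11,
     Jump_le 9 11 19,
     Add 10 3 3,
     Const 9 0,
     Mul 10 10 0,
     Add 10 10 9,
     Store 8 10,
     Add 8 8 1,
     Add 4 4 1,
     Jump_le 2 2 8,
     Store 6 4,
     Add 6 8 12,
     Add 3 3 1,
     Jump_le 2 2 4,
     Add 0 0 1]"

section \<open>Step bounds and loops\<close>

definition reaches_within :: "nat \<Rightarrow> nat \<Rightarrow> config \<Rightarrow> (config \<Rightarrow> bool) \<Rightarrow> bool" where
  "reaches_within w t s Q \<longleftrightarrow> (\<exists>k\<le>t. Q ((step w string_program ^^ k) s))"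

lemma reaches_withinI: "Q ((step w string_program ^^ k) s) \<Longrightarrow> k \<le> t \<Longrightarrow> reaches_within w t s Q"
  by (auto simp: reaches_within_def)

lemma reaches_within_trans:
  assumes "reaches_within w t s Q" "\<And>s'. Q s' \<Longrightarrow> reaches_within w u s' R"
  shows "reaches_within w (t + u) s R"
proof -
  from assms obtain j k where "j \<le> t" "k \<le> u"
      "R ((step w string_program ^^ k) ((step w string_program ^^ j) s))"
    unfolding reaches_within_def by blast
  then show ?thesis
    unfolding reaches_within_def by (intro exI[of _ "k + j"]) (auto simp: funpow_add)
qed

text \<open>The rule for loops, with \<open>Q i\<close> as the invariant after \<open>i\<close>
  rounds. Since \<open>t\<close> is only an upper bound, rounds that take different branches can
  share it.\<close>

lemma reaches_within_iterate:
  assumes "\<And>i s. i < n \<Longrightarrow> Q i s \<Longrightarrow> reaches_within w t s (Q (Suc i))" "Q 0 s"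
  shows "reaches_within w (n * t) s (Q n)"
  using assms(1)
proof (induction n)
  case 0
  then show ?case using assms(2) by (simp add: reaches_within_def)
next
  case (Suc n)
  have "reaches_within w (n * t + t) s (Q (Suc n))"
    by (rule reaches_within_trans[of _ _ _ "Q n"]) (use Suc in auto)
  then show ?case by (simp add: add.commute)
qed

section \<open>Memory layout and loop invariants\<close>

definition letter_addr :: "nat \<Rightarrow> nat \<Rightarrow> nat" where
  "letter_addr n a = 2 * n + 2 + a * (n + 1)"

definition input_stored :: "nat \<Rightarrow> nat list \<Rightarrow> (nat \<Rightarrow> nat) \<Rightarrow> bool" where
  "input_stored n MP M \<longleftrightarrow> (\<forall>i\<in>{1..2 * n + 1}. M i = entry MP i)"

definition letters_stored :: "nat \<Rightarrow> nat list \<Rightarrow> nat \<Rightarrow> (nat \<Rightarrow> nat) \<Rightarrow> bool" where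
  "letters_stored n MP a M \<longleftrightarrow>
     (\<forall>c<a. M (letter_addr n c) = n \<and> (\<forall>j<n. M (letter_addr n c + 1 + j) = letter_char MP c j))"

definition constants_loaded :: "nat \<Rightarrow> (nat \<Rightarrow> nat) \<Rightarrow> bool" where
  "constants_loaded n R \<longleftrightarrow> R 0 = 2 * n + 1 \<and> R 1 = 1 \<and> R 2 = 2 \<and> R 5 = 2 * n \<and> R 12 = 0"

definition outer_inv :: "nat \<Rightarrow> nat list \<Rightarrow> nat \<Rightarrow> config \<Rightarrow> bool" where
  "outer_inv n MP a s \<longleftrightarrow> pc s = 4 \<and> constants_loaded n (reg s) \<and>
     reg s 3 = a \<and> reg s 6 = letter_addr n a \<and>
     input_stored n MP (mem s) \<and> letters_stored n MP a (mem s)"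

text \<open>Nothing is required of cell \<open>letter_addr n a\<close>: the count goes there only
  after the inner loop.\<close>

definition inner_inv :: "nat \<Rightarrow> nat list \<Rightarrow> nat \<Rightarrow> nat \<Rightarrow> config \<Rightarrow> bool" where
  "inner_inv n MP a b s \<longleftrightarrow> pc s = 8 \<and> constants_loaded n (reg s) \<and>
     reg s 3 = a \<and> reg s 4 = b \<and> reg s 6 = letter_addr n a \<and> reg s 8 = letter_addr n a + 1 + b \<and>
     input_stored n MP (mem s) \<and> letters_stored n MP a (mem s) \<and>
     (\<forall>j<b. mem s (letter_addr n a + 1 + j) = letter_char MP a j)"

lemma letter_addr_Suc: "letter_addr n (Suc a) = letter_addr n a + n + 1"
  by (simp add: letter_addr_def)

lemma letter_addr_mono: "a \<le> b \<Longrightarrow> letter_addr n a \<le> letter_addr n b"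
  unfolding letter_addr_def by (intro add_left_mono mult_right_mono) simp_all

text \<open>Each letter occupies a block of \<open>n + 1\<close> cells, its count and
  \<open>n\<close> characters, and the blocks follow the input without gaps. Blocks of different
  letters are therefore disjoint, so writing one leaves the earlier ones intact.\<close>

lemma letter_addr_less: "c < a \<Longrightarrow> letter_addr n c + n < letter_addr n a"
  using letter_addr_mono[of "Suc c" a n] by (simp add: letter_addr_Suc)

lemma input_stored_upd:
  "input_stored n MP M \<Longrightarrow> p \<ge> 2 * n + 2 \<Longrightarrow> input_stored n MP (M(p := v))"
  by (auto simp: input_stored_def)

lemma letters_stored_upd:
  assumes "letters_stored n MP a M" "p \<ge> letter_addr n a"
  shows "letters_stored n MP a (M(p := v))"
  unfolding letters_stored_def
proof (intro allI impI conjI)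
  fix c assume c: "c < a"
  show "(M(p := v)) (letter_addr n c) = n"
    using assms c letter_addr_less[OF c, of n] by (auto simp: letters_stored_def)
  fix j assume "j < n"
  then show "(M(p := v)) (letter_addr n c + 1 + j) = letter_char MP c j"
    using assms c letter_addr_less[OF c, of n] by (auto simp: letters_stored_def)
qed

lemma letter_addr_ge: "letter_addr n a \<ge> 2 * n + 2"
  by (simp add: letter_addr_def)

text \<open>The bound that keeps the arithmetic of the program from wrapping around.\<close>

definition word_fits :: "nat \<Rightarrow> nat \<Rightarrow> bool" where
  "word_fits w n \<longleftrightarrow> 8 * (n + 1) ^ 2 < 2 ^ w"

lemma word_fits_linear:
  assumes "word_fits w n" "x \<le> 8 * (n + 1)"
  shows "x < 2 ^ w"
proof -
  have "8 * (n + 1) \<le> 8 * (n + 1) ^ 2" by (simp add: power2_eq_square)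
  then show ?thesis using assms unfolding word_fits_def by linarith
qed

lemma word_fits_letter_addr:
  assumes "word_fits w n" "a < n" "x \<le> letter_addr n (Suc a)"
  shows "x < 2 ^ w"
proof -
  have "letter_addr n (Suc a) \<le> letter_addr n n" using assms(2) by (intro letter_addr_mono) simp
  also have "\<dots> \<le> 8 * (n + 1) ^ 2" by (simp add: letter_addr_def power2_eq_square)
  finally show ?thesis using assms unfolding word_fits_def by linarith
qed

lemma word_fits_pair_char:
  assumes "word_fits w n" "a < n" "b < n" "x \<le> (a + b) * (2 * n + 1) + n"
  shows "x < 2 ^ w"
proof -
  have "(a + b) * (2 * n + 1) + n \<le> (2 * n) * (2 * n + 1) + n"
    using assms by (intro add_mono mult_mono) auto
  also have "\<dots> \<le> 8 * (n + 1) ^ 2" by (simp add: power2_eq_square)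
  finally show ?thesis using assms unfolding word_fits_def by linarith
qed

section \<open>Symbolic execution of the program\<close>

lemma step_string_program:
  "pc s < 30 \<Longrightarrow> step w string_program s = exec w (string_program ! pc s) s"
  by (simp add: step_def halted_def string_program_def)

text \<open>Stated for \<open>nth\<close>, so that rewriting unfolds the program only where an
  instruction is fetched and leaves \<open>step w string_program\<close> folded.\<close>

lemmas string_program_nth = fun_cong[OF arg_cong[OF string_program_def, of nth]]

text \<open>Peels off the first step of a numeral power, so that the simplifier runs the machine
  forward from a concrete program counter.\<close>

lemma funpow_numeral_apply: "(f ^^ numeral k) s = (f ^^ pred_numeral k) (f s)"
  by (simp add: numeral_eq_Suc funpow_swap1)

lemma inner_step:
  assumes len: "length MP = 2 * n + 1" and w: "word_fits w n" and a: "a < n" and b: "b < n"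
    and inv: "inner_inv n MP a b s"
  shows "reaches_within w 17 s (inner_inv n MP a (Suc b))"
proof -
  define h where "h = letter_addr n a"
  obtain R M where s: "s = \<lparr>pc = 8, reg = R, mem = M\<rparr>"
    using inv by (cases s) (auto simp: inner_inv_def)
  have R: "R 0 = 2 * n + 1" "R (Suc 0) = 1" "R 2 = 2" "R 5 = 2 * n" "R 12 = 0"
      "R 3 = a" "R 4 = b" "R 6 = h" "R 8 = h + 1 + b"
    using inv by (auto simp: inner_inv_def constants_loaded_def s h_def)
  have M: "input_stored n MP M" "letters_stored n MP a M"
      "\<forall>j<b. M (h + 1 + j) = letter_char MP a j"
    using inv by (auto simp: inner_inv_def s h_def)
  have MP: "M (Suc (Suc (a + b))) = entry MP (a + b + 2)"
    using M(1) a b by (auto simp: input_stored_def)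
  \<comment> \<open>These bounds remove the reductions modulo \<open>2 ^ w\<close> that execution
    produces; sums such as \<open>b + b\<close> are also given as \<open>2 * b\<close> to match
    either form.\<close>
  have small: "b + b < 2 ^ w" "a + a < 2 ^ w" "2 * b < 2 ^ w" "2 * a < 2 ^ w"
      "(a - b) + (b - a) < 2 ^ w" "a + b < 2 ^ w"
      "Suc (Suc (a + b)) < 2 ^ w" "Suc b < 2 ^ w" "Suc (h + b) < 2 ^ w" "Suc (Suc (h + b)) < 2 ^ w"
    using word_fits_linear[OF w] word_fits_letter_addr[OF w a] a b
    by (auto simp: letter_addr_Suc h_def)
  have chars: "(a + b) * (2 * n + 1) < 2 ^ w" "pair_char (2 * n + 1) a b < 2 ^ w"
      "(a + a) * (2 * n + 1) < 2 ^ w"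
    using word_fits_pair_char[OF w a b] word_fits_pair_char[OF w a a] a b
    by (auto simp: pair_char_def)
  \<comment> \<open>The effect common to both branches: one memory write, with the final registers
    \<open>R'\<close> left open.\<close>
  have inv': "inner_inv n MP a (Suc b) \<lparr>pc = 8, reg = R', mem = M(p := v)\<rparr>"
    if "constants_loaded n R'" "R' 3 = a" "R' 4 = Suc b" "R' 6 = h" "R' 8 = h + 2 + b"
      "p = h + 1 + b" "v = letter_char MP a b" for R' p v
    using that M input_stored_upd[OF M(1), of "h + 1 + b"] letters_stored_upd[OF M(2), of "h + 1 + b"]
      letter_addr_ge[of n a]
    by (auto simp: inner_inv_def h_def less_Suc_eq)
  note run = s funpow_numeral_apply step_string_program string_program_nth set_reg_def
  show ?thesis
  \<comment> \<open>A full round has 17 instructions. If the pair has to match, the jump skips the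
    two that replace the sum by \<open>a + a\<close> and the distance by \<open>0\<close>.\<close>
  proof (cases "mirrored MP a b")
    case True
    then have "(a - b) + (b - a) \<le> entry MP (a + b + 2)" by (simp add: mirrored_def)
    then have "inner_inv n MP a (Suc b) ((step w string_program ^^ 15) s)"
      using b small chars
      by (simp add: run R MP, intro inv')
        (simp_all add: constants_loaded_def R letter_char_def True pair_char_def len)
    then show ?thesis by (rule reaches_withinI) simp
  next
    case False
    then have "\<not> (a - b) + (b - a) \<le> entry MP (a + b + 2)" by (simp add: mirrored_def)
    then have "inner_inv n MP a (Suc b) ((step w string_program ^^ 17) s)"
      using b small chars
      by (simp add: run R MP, intro inv')
        (simp_all add: constants_loaded_def R letter_char_def False pair_char_def len)
    then show ?thesis by (rule reaches_withinI) simp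
  qed
qed

lemma outer_step:
  assumes len: "length MP = 2 * n + 1" and w: "word_fits w n" and a: "a < n"
    and inv: "outer_inv n MP a s"
  shows "reaches_within w (17 * n + 10) s (outer_inv n MP (Suc a))"
proof -
  define h where "h = letter_addr n a"
  have small: "a + a < 2 ^ w" "2 * a < 2 ^ w" "Suc h < 2 ^ w" "n + n < 2 ^ w" "2 * n < 2 ^ w"
      "Suc a < 2 ^ w" "Suc (h + n) < 2 ^ w"
    using word_fits_linear[OF w] word_fits_letter_addr[OF w a] a
    by (auto simp: letter_addr_Suc h_def)
  note run = funpow_numeral_apply step_string_program string_program_nth set_reg_def
  have enter: "reaches_within w 4 s (inner_inv n MP a 0)"
  proof (rule reaches_withinI)
    obtain R M where s: "s = \<lparr>pc = 4, reg = R, mem = M\<rparr>"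
      using inv by (cases s) (auto simp: outer_inv_def)
    have R: "R 0 = 2 * n + 1" "R (Suc 0) = 1" "R 2 = 2" "R 5 = 2 * n" "R 12 = 0"
        "R 3 = a" "R 6 = h"
      using inv by (auto simp: outer_inv_def constants_loaded_def s h_def)
    have M: "input_stored n MP M" "letters_stored n MP a M"
      using inv by (auto simp: outer_inv_def s)
    show "inner_inv n MP a 0 ((step w string_program ^^ 4) s)"
      using a small M by (simp add: s run R) (simp add: inner_inv_def constants_loaded_def R h_def)
  qed simp
  have leave: "reaches_within w 6 s' (outer_inv n MP (Suc a))" if inner: "inner_inv n MP a n s'" for s'
  proof (rule reaches_withinI)
    obtain R M where s: "s' = \<lparr>pc = 8, reg = R, mem = M\<rparr>"
      using inner by (cases s') (auto simp: inner_inv_def)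
    have R: "R 0 = 2 * n + 1" "R (Suc 0) = 1" "R 2 = 2" "R 5 = 2 * n" "R 12 = 0"
        "R 3 = a" "R 4 = n" "R 6 = h" "R 8 = h + 1 + n"
      using inner by (auto simp: inner_inv_def constants_loaded_def s h_def)
    have M: "input_stored n MP M" "letters_stored n MP a M"
        "\<forall>j<n. M (h + 1 + j) = letter_char MP a j"
      using inner by (auto simp: inner_inv_def s h_def)
    \<comment> \<open>Register 4 holds \<open>n\<close> when the inner loop ends. Storing it at
      \<open>h\<close> completes the block, and register 8 already points to the next one.\<close>
    have "letters_stored n MP a (M(h := n))" "input_stored n MP (M(h := n))"
      using M letters_stored_upd input_stored_upd letter_addr_ge by (simp_all add: h_def)
    moreover from this(1) M(3) have "letters_stored n MP (Suc a) (M(h := n))"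
      by (simp add: letters_stored_def less_Suc_eq h_def)
    ultimately show "outer_inv n MP (Suc a) ((step w string_program ^^ 6) s')"
      using a small by (simp add: s run R)
        (simp add: outer_inv_def constants_loaded_def R letter_addr_Suc h_def)
  qed simp
  have "reaches_within w (n * 17) s' (inner_inv n MP a n)" if "inner_inv n MP a 0 s'" for s'
    using inner_step[OF len w a] that by (rule reaches_within_iterate)
  from reaches_within_trans[OF enter reaches_within_trans[OF this leave]]
  show ?thesis by (simp add: add_ac mult.commute)
qed

section \<open>Reading off the output\<close>

lemma nth_concat_equal_lengths:
  assumes "\<forall>l\<in>set xs. length l = k" "i < length xs * k"
  shows "concat xs ! i = xs ! (i div k) ! (i mod k)"
  using assms
proof (induction xs arbitrary: i)
  case Nil
  then show ?case by simp
next
  case (Cons l xs)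
  show ?case
  proof (cases "i < k")
    case True
    then show ?thesis using Cons.prems by (simp add: nth_append)
  next
    case False
    then have "i div k = Suc ((i - k) div k)" "i mod k = (i - k) mod k"
      using Cons.prems(2) by (cases "k = 0"; simp add: le_div_geq le_mod_geq)+
    then show ?thesis using False Cons by (simp add: nth_append less_diff_conv2)
  qed
qed

text \<open>All blocks have length \<open>n + 1\<close>, so quotient and remainder of an offset give
  the letter and the cell within its block. Repeated characters in a list are harmless, as only its
  \<open>set\<close> counts.\<close>

lemma output_string_letter_lists:
  assumes "reg s 0 = 2 * n + 2" "letters_stored n MP n (mem s)"
  shows "output_string s (map set (letter_lists MP n))"
proof -
  define blocks where "blocks = map (\<lambda>l. length l # l) (letter_lists MP n)"
  have len: "\<forall>l\<in>set blocks. length l = n + 1" "length blocks = n"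
    by (auto simp: blocks_def letter_lists_def)
  have "mem s (reg s 0 + i) = concat blocks ! i" if "i < length (concat blocks)" for i
  proof -
    have "length (concat blocks) = n * (n + 1)"
      using len by (simp add: length_concat sum_list_triv map_eq_conv cong: map_cong)
    with that have i: "i < n * (n + 1)" by simp
    define a where "a = i div (n + 1)"
    define j where "j = i mod (n + 1)"
    have a: "a < n" using i by (simp add: a_def div_less_iff_less_mult)
    have j: "j < n + 1" by (simp add: j_def)
    have "reg s 0 + i = letter_addr n a + j"
      using assms(1) div_mult_mod_eq[of i "n + 1"] unfolding letter_addr_def a_def j_def by linarith
    moreover have "concat blocks ! i = blocks ! a ! j"
      unfolding a_def j_def using len i by (intro nth_concat_equal_lengths) simp_all
    \<comment> \<open>Cell \<open>0\<close> of a block is the count; cell \<open>Suc j'\<close> is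
      character number \<open>j'\<close>.\<close>
    moreover have "mem s (letter_addr n a + j) = blocks ! a ! j"
      using assms(2) a j
      by (cases j) (auto simp: letters_stored_def blocks_def letter_lists_def)
    ultimately show ?thesis by simp
  qed
  then show ?thesis unfolding output_string_def blocks_def Let_def by blast
qed

text \<open>The steps are 4 for initialization, \<open>17 * n + 10\<close> for each letter, and 3
  for the exit, whose last instruction moves register 0 from the end of the input to the first
  block.\<close>

lemma string_program_correct:
  assumes len: "length MP = 2 * n + 1" and w: "word_fits w n"
  shows "reaches_within w (17 * n ^ 2 + 10 * n + 7) (init_config MP)
    (\<lambda>s. halted string_program s \<and> output_string s (map set (letter_lists MP n)))"
proof -
  have small: "Suc (Suc (2 * n)) < 2 ^ w" "2 * n < 2 ^ w" "Suc 0 < 2 ^ w" "2 < (2::nat) ^ w"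
    by (rule word_fits_linear[OF w], simp)+
  from small(3) have "0 < w" by (cases w) simp_all
  note run = funpow_numeral_apply step_string_program string_program_nth set_reg_def
  have start: "reaches_within w 4 (init_config MP) (outer_inv n MP 0)"
  proof (rule reaches_withinI)
    show "outer_inv n MP 0 ((step w string_program ^^ 4) (init_config MP))"
      using small by (simp add: init_config_def run len)
        (simp add: outer_inv_def constants_loaded_def letter_addr_def input_stored_def
          letters_stored_def \<open>0 < w\<close>)
  qed simp
  have stop: "reaches_within w 3 s
      (\<lambda>s. halted string_program s \<and> output_string s (map set (letter_lists MP n)))"
    if outer: "outer_inv n MP n s" for s
  proof (rule reaches_withinI)
    obtain R M where s: "s = \<lparr>pc = 4, reg = R, mem = M\<rparr>"
      using outer by (cases s) (auto simp: outer_inv_def)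
    have R: "R 0 = 2 * n + 1" "R (Suc 0) = 1" "R 5 = 2 * n" "R 3 = n"
      using outer by (auto simp: outer_inv_def constants_loaded_def s)
    have "letters_stored n MP n M"
      using outer by (auto simp: outer_inv_def s)
    then show "halted string_program ((step w string_program ^^ 3) s) \<and>
        output_string ((step w string_program ^^ 3) s) (map set (letter_lists MP n))"
      using small by (simp add: s run R)
        (simp add: halted_def string_program_def output_string_letter_lists)
  qed simp
  have "reaches_within w (n * (17 * n + 10)) s (outer_inv n MP n)" if "outer_inv n MP 0 s" for s
    using outer_step[OF len w] that by (rule reaches_within_iterate)
  from reaches_within_trans[OF start reaches_within_trans[OF this stop]]
  show ?thesis by (simp add: algebra_simps power2_eq_square)
qed

lemma computes_within_letter_lists:
  assumes len: "length MP = 2 * n + 1" and feas: "feasible MP" and w: "word_fits w n"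
  shows "computes_within w string_program (17 * n ^ 2 + 10 * n + 7) MP
    (map set (letter_lists MP n))"
proof -
  have "v < 2 ^ w" if v: "v \<in> set MP" for v
  proof -
    from v obtain i where "i < length MP" "v = MP ! i" by (auto simp: in_set_conv_nth)
    then have "v \<le> length MP"
      using feasible_bounds(2)[OF feas, of "Suc i"] by (simp add: entry_def)
    then show ?thesis using len by (intro word_fits_linear[OF w]) simp
  qed
  moreover have "length MP < 2 ^ w" using word_fits_linear[OF w] len by simp
  ultimately show ?thesis
    using string_program_correct[OF len w]
    by (simp add: computes_within_def reaches_within_def Let_def)
qed

theorem theorem3:
  "\<exists>(P :: program) (T :: nat \<Rightarrow> nat) (w :: nat \<Rightarrow> nat).
     (\<lambda>n. real (T n)) \<in> O(\<lambda>n. real n ^ 2) \<and>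
     (\<lambda>n. real (w n)) \<in> O(\<lambda>n. ln (real n)) \<and>
     (\<forall>n MP. length MP = 2 * n + 1 \<and> feasible MP \<and> \<not> regular_array MP \<longrightarrow>
        (\<exists>x :: nat set list.
           indeterminate_string x \<and> max_palindrome_array (star x) = MP \<and>
           computes_within (w n) P (T n) MP x))"
proof -
  define T :: "nat \<Rightarrow> nat" where "T n = 17 * n ^ 2 + 10 * n + 7" for n
  \<comment> \<open>The logarithm of the bound in \<open>word_fits\<close>, rounded up; the added 1
    makes the inequality strict.\<close>
  define w :: "nat \<Rightarrow> nat" where "w n = nat \<lceil>log 2 (8 * (real n + 1) ^ 2)\<rceil> + 1" for n
  have T: "(\<lambda>n. real (T n)) \<in> O(\<lambda>n. real n ^ 2)"
    unfolding T_def by real_asymp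
  have w: "(\<lambda>n. real (w n)) \<in> O(\<lambda>n. ln (real n))"
    unfolding w_def by real_asymp
  have fits: "word_fits (w n) n" for n
  proof -
    let ?l = "log 2 (8 * (real n + 1) ^ 2)"
    have "8 * (real n + 1) ^ 2 = 2 powr ?l" by simp
    also have "\<dots> < 2 powr real (w n)"
      unfolding w_def by (intro powr_less_mono) linarith+
    also have "\<dots> = 2 ^ w n" by (simp add: powr_realpow)
    finally have "real (8 * (n + 1) ^ 2) < real (2 ^ w n)" by (simp add: add.commute)
    then show ?thesis unfolding word_fits_def of_nat_less_iff .
  qed
  have "\<exists>x :: nat set list. indeterminate_string x \<and> max_palindrome_array (star x) = MP \<and>
      computes_within (w n) string_program (T n) MP x"
    if MP: "length MP = 2 * n + 1" "feasible MP" "\<not> regular_array MP" for n MP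
  proof (intro exI conjI)
    let ?x = "map set (letter_lists MP n)"
    show array: "max_palindrome_array (star ?x) = MP"
      using MP by (intro max_palindrome_array_letter_lists)
    \<comment> \<open>If this string were regular, it would witness
      \<open>regular_array MP\<close>.\<close>
    then show "indeterminate_string ?x"
      using MP is_string_letter_lists unfolding indeterminate_string_def regular_array_def by blast
    show "computes_within (w n) string_program (T n) MP ?x"
      unfolding T_def using MP fits by (intro computes_within_letter_lists)
  qed
  with T w show ?thesis by blast
qed

end
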